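(* Let $D>0$, $H>0$, $d_{\min}\ge0$, $\beta_0>0$, $\sigma^2>0$, $Q>0$, $0<\tilde\tau_E<T$. Let $\mathbf{w}_1=(-D/2,0)$ and $\mathbf{w}_2=(D/2,0)$. Consider the problem of maximizing $$\sum_{k=1}^2\frac{T-\tilde\tau_E}{T}\log_2\left(1+\frac12\sum_{m=1}^2\frac{Q\beta_0/\sigma^2}{\|\mathbf{q}_m-\mathbf{w}_k\|^2+H^2}\right)$$ over symmetric fixed hovering locations $\mathbf{q}_1(t)=\mathbf{q}_1=(x,0)$, $\mathbf{q}_2(t)=\mathbf{q}_2=(-x,0)$, $t\in(\tilde\tau_E,T]$, with $x\in\mathbb{R}$, $|x|\ge d_{\min}/2$. Then optimal hovering locations are as follows. (i) If $D\le2H/\sqrt3$, the maximum is attained at $\mathbf{q}_1(t)=(-d_{\min}/2,0)$ and $\mathbf{q}_2(t)=(d_{\min}/2,0)$ for all $t\in(\tilde\tau_E,T]$. (ii) If $D>2H/\sqrt3$, the maximum is attained at $\mathbf{q}_1(t)=(-\epsilon,0)$ and $\mathbf{q}_2(t)=(\epsilon,0)$ for all $t\in(\tilde\tau_E,T]$, where $$\epsilon=\max\left(\sqrt{-\left(\tfrac{D^2}{4}+H^2\right)+\sqrt{\tfrac{D^4}{4}+H^2D^2}},\ \tfrac{d_{\min}}{2}\right)\le\max\left(\tfrac{d_{\min}}{2},\tfrac{D}{2}\right).$$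
   Context: Two UAVs at altitude $H$ with horizontal positions $\mathbf{q}_1,\mathbf{q}_2\in\mathbb{R}^2$ jointly detect (coordinated multi-point reception, CoMP) the uplink signals of two ground devices at horizontal positions $\mathbf{w}_1,\mathbf{w}_2$ during the interval $(\tilde\tau_E,T]$. Both devices transmit with the same constant power $Q$ (the energy harvested by each device during $(0,\tilde\tau_E]$ divided by $T-\tilde\tau_E$). $\beta_0$ is the channel power gain at unit distance, $\sigma^2$ the noise power, $d_{\min}$ the minimum allowed distance between the UAVs. The $k$-th summand in the objective is the (approximate) average rate of device $k$; for symmetric placements both devices have equal rates, so maximizing the sum is equivalent to maximizing the common (minimum) rate. *)

theory Defs
  imports "HOL-Analysis.Analysis"
begin

text \<open>
  A pair of horizontal positions is an element of \<^typ>\<open>real^2^2\<close>: \<open>q $ m\<close> is the position of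
  UAV \<open>m\<close> and \<open>w $ k\<close> that of device \<open>k\<close>. UAVs that hover have a position that does not depend
  on the time \<open>t \<in> (\<tau>, T]\<close>, so the optimization variable is the pair of positions itself.
\<close>

text \<open>
  Approximate CoMP rate of a device at \<open>wk\<close>, averaged over \<open>(0, T]\<close>; the device transmits only
  during \<open>(\<tau>, T]\<close>.
\<close>

definition comp_rate ::
  "real \<Rightarrow> real \<Rightarrow> real \<Rightarrow> real \<Rightarrow> real \<Rightarrow> real \<Rightarrow> real^2 \<Rightarrow> real^2^2 \<Rightarrow> real" where
  "comp_rate H \<beta>0 \<sigma> Q \<tau> T wk q =
     (T - \<tau>) / T * log 2 (1 + 1/2 * (\<Sum>m\<in>UNIV. (Q * \<beta>0 / \<sigma>\<^sup>2) / ((norm (q $ m - wk))\<^sup>2 + H\<^sup>2)))"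

definition sum_rate ::
  "real \<Rightarrow> real \<Rightarrow> real \<Rightarrow> real \<Rightarrow> real \<Rightarrow> real \<Rightarrow> real^2^2 \<Rightarrow> real^2^2 \<Rightarrow> real" where
  "sum_rate H \<beta>0 \<sigma> Q \<tau> T w q = (\<Sum>k\<in>UNIV. comp_rate H \<beta>0 \<sigma> Q \<tau> T (w $ k) q)"

definition symmetric_placements :: "real \<Rightarrow> (real^2^2) set" where
  "symmetric_placements dmin =
     {vector [vector [x, 0], vector [-x, 0]] | x. \<bar>x\<bar> \<ge> dmin / 2}"

end

theory Submission
  imports Defs
begin

text \<open>
  With \<open>a = D\<^sup>2 / 4 + H\<^sup>2\<close> and \<open>u = x\<^sup>2 + a\<close>, both devices see the channel gain
  \<open>2 * u / (u\<^sup>2 - D\<^sup>2 * u + D\<^sup>2 * a) = 2 / (u + D\<^sup>2 * a / u - D\<^sup>2)\<close>. The map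
  \<open>u \<mapsto> u + D\<^sup>2 * a / u\<close> is minimal at \<open>u = D * sqrt a\<close> and increasing beyond, and this point
  corresponds to a real \<open>x \<noteq> 0\<close> iff \<open>D\<^sup>2 > a\<close>, i.e. \<open>D > 2 * H / sqrt 3\<close>.
\<close>

definition symmetric_gain :: "real \<Rightarrow> real \<Rightarrow> real \<Rightarrow> real" where
  "symmetric_gain D H x = 1 / ((x - D / 2)\<^sup>2 + H\<^sup>2) + 1 / ((x + D / 2)\<^sup>2 + H\<^sup>2)"

lemma symmetric_gain_minus: "symmetric_gain D H (- x) = symmetric_gain D H x"
proof -
  have "(- x - D / 2)\<^sup>2 = (x + D / 2)\<^sup>2" "(- x + D / 2)\<^sup>2 = (x - D / 2)\<^sup>2"
    using power2_minus[of "x + D / 2"] power2_commute[of "D / 2" x] by simp_all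
  then show ?thesis
    by (simp add: symmetric_gain_def)
qed

lemma symmetric_gain_nonneg: "symmetric_gain D H x \<ge> 0"
  by (simp add: symmetric_gain_def)

text \<open>With \<open>u = x\<^sup>2 + a\<close>, the two denominators of the gain are
  \<open>u - D * x\<close> and \<open>u + D * x\<close>. Their sum is \<open>2 * u\<close> and their
  product is \<open>u\<^sup>2 - D\<^sup>2 * x\<^sup>2\<close>, where
  \<open>x\<^sup>2 = u - a\<close>. The quadratic in \<open>u\<close> is positive because it is this
  product.\<close>

lemma symmetric_gain_eq:
  fixes D H :: real
  assumes "H \<noteq> 0"
  defines "a \<equiv> D\<^sup>2 / 4 + H\<^sup>2"
  shows "symmetric_gain D H x = 2 * (x\<^sup>2 + a) / ((x\<^sup>2 + a)\<^sup>2 - D\<^sup>2 * (x\<^sup>2 + a) + D\<^sup>2 * a)"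
    and "(x\<^sup>2 + a)\<^sup>2 - D\<^sup>2 * (x\<^sup>2 + a) + D\<^sup>2 * a > 0"
proof -
  let ?A = "(x - D / 2)\<^sup>2 + H\<^sup>2" and ?B = "(x + D / 2)\<^sup>2 + H\<^sup>2"
  have pos: "?A > 0" "?B > 0"
    using assms(1) by (simp_all add: add_nonneg_pos)
  have prod: "?A * ?B = (x\<^sup>2 + a)\<^sup>2 - D\<^sup>2 * (x\<^sup>2 + a) + D\<^sup>2 * a"
    unfolding a_def by (simp add: power2_eq_square algebra_simps)
  have add: "?A + ?B = 2 * (x\<^sup>2 + a)"
    unfolding a_def by (simp add: power2_eq_square field_simps)
  have "1 / A + 1 / B = (A + B) / (A * B)" if "A > 0" "B > 0" for A B :: real
    using that by (simp add: field_simps)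
  then have "symmetric_gain D H x = (?A + ?B) / (?A * ?B)"
    unfolding symmetric_gain_def using pos by blast
  then show "symmetric_gain D H x = 2 * (x\<^sup>2 + a) / ((x\<^sup>2 + a)\<^sup>2 - D\<^sup>2 * (x\<^sup>2 + a) + D\<^sup>2 * a)"
    by (simp only: prod add)
  show "(x\<^sup>2 + a)\<^sup>2 - D\<^sup>2 * (x\<^sup>2 + a) + D\<^sup>2 * a > 0"
    using mult_pos_pos[OF pos] by (simp only: prod)
qed

text \<open>Comparison without derivatives: cross-multiplying the closed forms at
  \<open>u = x\<^sup>2 + a\<close> and \<open>v = y\<^sup>2 + a\<close>, the difference of the two
  sides factors as \<open>2 * (u - v) * (u * v - D\<^sup>2 * a)\<close>. Only the sign of this
  product has to be settled later.\<close>

lemma symmetric_gain_le: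
  fixes D H :: real
  assumes "H \<noteq> 0"
  defines "a \<equiv> D\<^sup>2 / 4 + H\<^sup>2"
  assumes "(x\<^sup>2 - y\<^sup>2) * ((x\<^sup>2 + a) * (y\<^sup>2 + a) - D\<^sup>2 * a) \<ge> 0"
  shows "symmetric_gain D H x \<le> symmetric_gain D H y"
proof -
  define u v where "u = x\<^sup>2 + a" and "v = y\<^sup>2 + a"
  have pos: "u\<^sup>2 - D\<^sup>2 * u + D\<^sup>2 * a > 0" "v\<^sup>2 - D\<^sup>2 * v + D\<^sup>2 * a > 0"
    using symmetric_gain_eq(2)[OF assms(1)] unfolding a_def u_def v_def by blast+
  have "(u - v) * (u * v - D\<^sup>2 * a) \<ge> 0"
    using assms(3) by (simp add: u_def v_def)
  then have "2 * u * (v\<^sup>2 - D\<^sup>2 * v + D\<^sup>2 * a) \<le> 2 * v * (u\<^sup>2 - D\<^sup>2 * u + D\<^sup>2 * a)"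
    by (simp add: power2_eq_square algebra_simps)
  then have "2 * u / (u\<^sup>2 - D\<^sup>2 * u + D\<^sup>2 * a) \<le> 2 * v / (v\<^sup>2 - D\<^sup>2 * v + D\<^sup>2 * a)"
    using pos by (simp add: frac_le_eq divide_le_eq le_divide_eq mult.commute)
  then show ?thesis
    using symmetric_gain_eq(1)[OF assms(1)] unfolding a_def u_def v_def by simp
qed

lemma norm_diff_axis_squared:
  "(norm (vector [x, 0] - vector [y, 0] :: real^2))\<^sup>2 = (x - y)\<^sup>2"
  unfolding power2_norm_eq_inner by (simp add: inner_vec_def sum_2 power2_eq_square)

text \<open>Reflection in the origin swaps the two UAVs and also the two devices, so both devices
  have the same rate; hence the factor 2.\<close>

lemma sum_rate_symmetric:
  "sum_rate H \<beta>0 \<sigma> Q \<tau> T (vector [vector [- D / 2, 0], vector [D / 2, 0]])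
     (vector [vector [x, 0], vector [- x, 0]]) =
   2 * ((T - \<tau>) / T * log 2 (1 + 1/2 * (Q * \<beta>0 / \<sigma>\<^sup>2 * symmetric_gain D H x)))"
proof -
  have "(- x - D / 2)\<^sup>2 = (x + D / 2)\<^sup>2" "(D / 2 - x)\<^sup>2 = (x - D / 2)\<^sup>2"
    using power2_minus[of "x + D / 2"] power2_commute[of "D / 2" x] by simp_all
  then show ?thesis
    by (simp add: sum_rate_def comp_rate_def sum_2 norm_diff_axis_squared symmetric_gain_def
        algebra_simps)
qed

text \<open>The objective is a nondecreasing function of the gain, so the optimization reduces to
  comparing gains. The gain is even in \<open>x\<close>, which lets the first UAV stand on the left,
  at \<open>-c\<close>.\<close>

lemma is_arg_max_symmetric:
  fixes T \<tau> :: real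
  assumes "\<tau> < T" "T > 0" "Q * \<beta>0 / \<sigma>\<^sup>2 \<ge> 0" "dmin / 2 \<le> c"
    and "\<And>x. \<bar>x\<bar> \<ge> dmin / 2 \<Longrightarrow> symmetric_gain D H x \<le> symmetric_gain D H c"
  shows "is_arg_max
    (sum_rate H \<beta>0 \<sigma> Q \<tau> T (vector [vector [- D / 2, 0], vector [D / 2, 0]]))
    (\<lambda>q. q \<in> symmetric_placements dmin) (vector [vector [- c, 0], vector [c, 0]])"
  unfolding is_arg_max_linorder
proof (intro conjI allI impI)
  show "vector [vector [- c, 0], vector [c, 0]] \<in> symmetric_placements dmin"
    unfolding symmetric_placements_def using assms(4) by (intro CollectI exI[of _ "- c"]) auto
next
  fix q :: "real^2^2"
  assume "q \<in> symmetric_placements dmin"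
  then obtain x where q: "q = vector [vector [x, 0], vector [- x, 0]]" and x: "\<bar>x\<bar> \<ge> dmin / 2"
    unfolding symmetric_placements_def by blast
  let ?P = "Q * \<beta>0 / \<sigma>\<^sup>2"
  have "?P * symmetric_gain D H x \<le> ?P * symmetric_gain D H (- c)"
    unfolding symmetric_gain_minus using assms(3) assms(5)[OF x] by (rule mult_left_mono[rotated])
  moreover have "?P * symmetric_gain D H x \<ge> 0"
    using assms(3) symmetric_gain_nonneg by (rule mult_nonneg_nonneg)
  ultimately have "log 2 (1 + 1/2 * (?P * symmetric_gain D H x))
      \<le> log 2 (1 + 1/2 * (?P * symmetric_gain D H (- c)))"
    by (intro log_mono) linarith+
  \<comment> \<open>The second position is written \<open>- (- c)\<close> to match
    \<open>sum_rate_symmetric\<close> at \<open>x = -c\<close>.\<close>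
  then have "sum_rate H \<beta>0 \<sigma> Q \<tau> T (vector [vector [- D / 2, 0], vector [D / 2, 0]]) q
      \<le> sum_rate H \<beta>0 \<sigma> Q \<tau> T (vector [vector [- D / 2, 0], vector [D / 2, 0]])
          (vector [vector [- c, 0], vector [- (- c), 0]])"
    unfolding q sum_rate_symmetric using assms(1,2) by (intro mult_left_mono) auto
  then show "sum_rate H \<beta>0 \<sigma> Q \<tau> T (vector [vector [- D / 2, 0], vector [D / 2, 0]]) q
      \<le> sum_rate H \<beta>0 \<sigma> Q \<tau> T (vector [vector [- D / 2, 0], vector [D / 2, 0]])
          (vector [vector [- c, 0], vector [c, 0]])"
    by simp
qed

text \<open>Once \<open>c\<close> is at or past the critical point, both
  \<open>x\<^sup>2 + a\<close> and \<open>c\<^sup>2 + a\<close> are at least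
  \<open>D * sqrt a\<close>, so their product is at least \<open>D\<^sup>2 * a\<close> and both
  factors of the criterion are nonnegative.\<close>

lemma symmetric_gain_le_of_critical_le:
  assumes "H \<noteq> 0" "D \<ge> 0" "c \<ge> 0" "c \<le> \<bar>x\<bar>"
    and "D * sqrt (D\<^sup>2 / 4 + H\<^sup>2) \<le> c\<^sup>2 + (D\<^sup>2 / 4 + H\<^sup>2)"
  shows "symmetric_gain D H x \<le> symmetric_gain D H c"
proof (rule symmetric_gain_le[OF assms(1)])
  let ?a = "D\<^sup>2 / 4 + H\<^sup>2"
  have sq: "c\<^sup>2 \<le> x\<^sup>2"
    using power_mono[OF assms(4,3), of 2] by simp
  have "(D * sqrt ?a) * (D * sqrt ?a) \<le> (x\<^sup>2 + ?a) * (c\<^sup>2 + ?a)"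
    using assms(2,5) sq by (intro mult_mono) auto
  moreover have "(D * sqrt ?a) * (D * sqrt ?a) = D\<^sup>2 * ?a"
    by (simp add: power2_eq_square)
  ultimately show "(x\<^sup>2 - c\<^sup>2) * ((x\<^sup>2 + ?a) * (c\<^sup>2 + ?a) - D\<^sup>2 * ?a) \<ge> 0"
    using sq by (intro mult_nonneg_nonneg) linarith+
qed

text \<open>At the critical value \<open>v = D * sqrt a\<close> the criterion becomes
  \<open>v * (u - v)\<^sup>2\<close>, so \<open>c\<close> beats every real \<open>x\<close>, on
  either side of it.\<close>

lemma symmetric_gain_le_critical:
  assumes "H \<noteq> 0" "D \<ge> 0"
    and crit: "c\<^sup>2 + (D\<^sup>2 / 4 + H\<^sup>2) = D * sqrt (D\<^sup>2 / 4 + H\<^sup>2)"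
  shows "symmetric_gain D H x \<le> symmetric_gain D H c"
proof (rule symmetric_gain_le[OF assms(1)])
  define v where "v = D * sqrt (D\<^sup>2 / 4 + H\<^sup>2)"
  have v: "v \<ge> 0" "v * v = D\<^sup>2 * (D\<^sup>2 / 4 + H\<^sup>2)"
    using assms(2) by (simp_all add: v_def power2_eq_square)
  define u where "u = x\<^sup>2 + (D\<^sup>2 / 4 + H\<^sup>2)"
  have diff: "x\<^sup>2 - c\<^sup>2 = u - v"
    using crit by (simp add: u_def v_def)
  have "(u - v) * (u * v - v * v) = v * (u - v)\<^sup>2"
    by (simp add: power2_eq_square algebra_simps)
  then have "(u - v) * (u * v - v * v) \<ge> 0"
    by (simp only: mult_nonneg_nonneg[OF v(1) zero_le_power2])
  then show "(x\<^sup>2 - c\<^sup>2) * ((x\<^sup>2 + (D\<^sup>2 / 4 + H\<^sup>2)) * (c\<^sup>2 + (D\<^sup>2 / 4 + H\<^sup>2))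
      - D\<^sup>2 * (D\<^sup>2 / 4 + H\<^sup>2)) \<ge> 0"
    by (simp only: diff crit u_def[symmetric] v_def[symmetric] v(2))
qed

theorem lemma4p2:
  fixes D H dmin \<beta>0 \<sigma> Q \<tau> T :: real and w :: "real^2^2"
  assumes "D > 0" and "H > 0" and "dmin \<ge> 0" and "\<beta>0 > 0" and "\<sigma>\<^sup>2 > 0" and "Q > 0"
    and "0 < \<tau>" and "\<tau> < T"
    and "w = vector [vector [- D / 2, 0], vector [D / 2, 0]]"
  shows "(D \<le> 2 * H / sqrt 3 \<longrightarrow>
            is_arg_max (sum_rate H \<beta>0 \<sigma> Q \<tau> T w) (\<lambda>q. q \<in> symmetric_placements dmin)
              (vector [vector [- dmin / 2, 0], vector [dmin / 2, 0]])) \<and>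
         (D > 2 * H / sqrt 3 \<longrightarrow>
            (let \<epsilon> = max (sqrt (- (D\<^sup>2 / 4 + H\<^sup>2) + sqrt (D ^ 4 / 4 + H\<^sup>2 * D\<^sup>2))) (dmin / 2) in
               is_arg_max (sum_rate H \<beta>0 \<sigma> Q \<tau> T w) (\<lambda>q. q \<in> symmetric_placements dmin)
                 (vector [vector [- \<epsilon>, 0], vector [\<epsilon>, 0]]) \<and>
               \<epsilon> \<le> max (dmin / 2) (D / 2)))"
proof -
  define a where "a = D\<^sup>2 / 4 + H\<^sup>2"
  have a: "a > 0"
    using \<open>H > 0\<close> by (simp add: a_def add_nonneg_pos)
  have P: "Q * \<beta>0 / \<sigma>\<^sup>2 \<ge> 0" and T: "T > 0"
    using assms by simp_all
  \<comment> \<open>Squaring gives \<open>3 * D\<^sup>2 \<le> 4 * H\<^sup>2\<close>, which is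
    \<open>D\<^sup>2 \<le> D\<^sup>2 / 4 + H\<^sup>2\<close>.\<close>
  have thr: "D \<le> 2 * H / sqrt 3 \<longleftrightarrow> D\<^sup>2 \<le> a"
  proof -
    have "D \<le> 2 * H / sqrt 3 \<longleftrightarrow> D * sqrt 3 \<le> 2 * H"
      by (simp add: field_simps)
    also have "\<dots> \<longleftrightarrow> (D * sqrt 3)\<^sup>2 \<le> (2 * H)\<^sup>2"
      using \<open>D > 0\<close> \<open>H > 0\<close> using abs_le_square_iff[of "D * sqrt 3" "2 * H"] by simp
    also have "\<dots> \<longleftrightarrow> D\<^sup>2 \<le> a"
      unfolding a_def by (simp add: power_mult_distrib) linarith
    finally show ?thesis .
  qed
  \<comment> \<open>The value \<open>u = a\<close> belongs to \<open>x = 0\<close>: this decides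
    whether the critical point lies at or below the whole range of \<open>u\<close>.\<close>
  have crit: "D * sqrt a \<le> a \<longleftrightarrow> D\<^sup>2 \<le> a"
  proof -
    have "D * sqrt a \<le> a \<longleftrightarrow> D * sqrt a \<le> sqrt a * sqrt a"
      using a by simp
    also have "\<dots> \<longleftrightarrow> D \<le> sqrt a"
      using a by (intro mult_le_cancel_right_pos) simp
    also have "\<dots> \<longleftrightarrow> D\<^sup>2 \<le> a"
      using \<open>D > 0\<close> a by (metis less_eq_real_def real_le_rsqrt real_sqrt_le_iff real_sqrt_unique)
    finally show ?thesis .
  qed
  \<comment> \<open>Used in both regimes: in (i), and in (ii) when the distance constraint pushes
    the UAVs past the critical point.\<close>
  have beyond: "symmetric_gain D H x \<le> symmetric_gain D H (dmin / 2)"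
    if "D * sqrt a \<le> (dmin / 2)\<^sup>2 + a" "dmin / 2 \<le> \<bar>x\<bar>" for x
    using that assms by (intro symmetric_gain_le_of_critical_le) (auto simp: a_def)
  show ?thesis
  proof (intro conjI impI)
    assume "D \<le> 2 * H / sqrt 3"
    then have "D * sqrt a \<le> (dmin / 2)\<^sup>2 + a"
      using thr crit by (simp add: add_increasing)
    then show "is_arg_max (sum_rate H \<beta>0 \<sigma> Q \<tau> T w) (\<lambda>q. q \<in> symmetric_placements dmin)
              (vector [vector [- dmin / 2, 0], vector [dmin / 2, 0]])"
      using is_arg_max_symmetric[OF \<open>\<tau> < T\<close> T P order.refl beyond] assms(9) by simp
  next
    assume "D > 2 * H / sqrt 3"
    then have gt: "D * sqrt a > a"
      using thr crit by linarith
    \<comment> \<open>The nonnegative \<open>x\<close> at which \<open>u\<close> takes the critical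
      value \<open>D * sqrt a\<close>.\<close>
    define e where "e = sqrt (D * sqrt a - a)"
    have e: "e \<ge> 0" "e\<^sup>2 + a = D * sqrt a"
      using gt by (simp_all add: e_def)
    have "sqrt (D ^ 4 / 4 + H\<^sup>2 * D\<^sup>2) = sqrt (D\<^sup>2 * a)"
      by (simp add: a_def power2_eq_square power4_eq_xxxx algebra_simps)
    then have "sqrt (D ^ 4 / 4 + H\<^sup>2 * D\<^sup>2) = D * sqrt a"
      using \<open>D > 0\<close> by (simp add: real_sqrt_mult)
    then have eps: "sqrt (- (D\<^sup>2 / 4 + H\<^sup>2) + sqrt (D ^ 4 / 4 + H\<^sup>2 * D\<^sup>2)) = e"
      by (simp add: e_def a_def)
    have opt: "symmetric_gain D H x \<le> symmetric_gain D H (max e (dmin / 2))"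
      if x: "dmin / 2 \<le> \<bar>x\<bar>" for x
    \<comment> \<open>Either the unconstrained maximizer \<open>e\<close> is feasible, or every
      feasible \<open>x\<close> lies beyond it and the nearest one, \<open>dmin / 2\<close>,
      wins.\<close>
    proof (cases "dmin / 2 \<le> e")
      case True
      then show ?thesis
        using symmetric_gain_le_critical[of H D e x] e assms(1,2) by (simp add: a_def max_absorb1)
    next
      case False
      then have "e\<^sup>2 \<le> (dmin / 2)\<^sup>2"
        using e(1) by (intro power_mono) auto
      then have "D * sqrt a \<le> (dmin / 2)\<^sup>2 + a"
        using e(2) by linarith
      then show ?thesis
        using beyond[OF _ x] False by simp
    qed
    \<comment> \<open>AM-GM in the form \<open>D * sqrt a \<le> (D / 2)\<^sup>2 + a\<close> bounds
      \<open>e\<close> by \<open>D / 2\<close>.\<close>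
    have "0 \<le> (D / 2 - sqrt a)\<^sup>2"
      by simp
    also have "\<dots> = (D / 2)\<^sup>2 - D * sqrt a + a"
      using a by (simp add: power2_diff)
    finally have "e\<^sup>2 \<le> (D / 2)\<^sup>2"
      using e(2) by linarith
    then have "e \<le> D / 2"
      by (rule power2_le_imp_le) (use \<open>D > 0\<close> in simp)
    then have le: "max e (dmin / 2) \<le> max (dmin / 2) (D / 2)"
      by auto
    have "is_arg_max (sum_rate H \<beta>0 \<sigma> Q \<tau> T w) (\<lambda>q. q \<in> symmetric_placements dmin)
        (vector [vector [- max e (dmin / 2), 0], vector [max e (dmin / 2), 0]])"
      unfolding assms(9) by (rule is_arg_max_symmetric[OF \<open>\<tau> < T\<close> T P max.cobounded2 opt])
    then show "let \<epsilon> = max (sqrt (- (D\<^sup>2 / 4 + H\<^sup>2) + sqrt (D ^ 4 / 4 + H\<^sup>2 * D\<^sup>2))) (dmin / 2) in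
               is_arg_max (sum_rate H \<beta>0 \<sigma> Q \<tau> T w) (\<lambda>q. q \<in> symmetric_placements dmin)
                 (vector [vector [- \<epsilon>, 0], vector [\<epsilon>, 0]]) \<and>
               \<epsilon> \<le> max (dmin / 2) (D / 2)"
      unfolding eps Let_def using le by (rule conjI)
  qed
qed

end
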